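(* Let $G$ be a topological group containing a subspace homeomorphic to $W$. Then $G$ is not homeomorphic to a subspace of any countable product $\prod_{n=1}^\infty X_n$ (with the product topology) of topological spaces $X_n$ each of which has property $(\mathcal M)$.
   Context: $K=\{x_0\}\cup\{x_{n,m}:n,m\in\mathbb N\}\subset\mathbb R^2$ where $x_0=(0,0)$ and $x_{n,m}=(\tfrac1n,\tfrac1{nm})$, with the subspace topology. Let $S_0=\{0\}\cup\{\tfrac1n:n\in\mathbb N\}$ and $V=(\mathbb N\times S_0)/(\mathbb N\times\{0\})$ (quotient topology, $\mathbb N$ discrete); write $y_0$ for the image of $\mathbb N\times\{0\}$ and $y_{n,m}$ for the image of $(n,\tfrac1m)$. In $K\times V$ (product topology) consider the points $z_0=(x_0,y_0)$, $z_{n,m}=(x_{n,m},y_0)$, $z_{n,m,p,q}=(x_{n,m},y_{p,n+q})$ for $n,m,p,q\in\mathbb N$. Let $W_0=\{z_0\}\cup\{z_{n,m}:n,m\in\mathbb N\}$ and $W_p=W_{p-1}\cup\{z_{n,m,p,q}:n,m,q\in\mathbb N\}$ for $p\ge1$, each with the subspace topology from $K\times V$. The test space $W$ is the set $\bigcup_{p\ge0}W_p$ with the direct limit topology: $U\subset W$ is open iff $U\cap W_p$ is open in $W_p$ for every $p$. A space $X$ has property $(\mathcal M)$ if for every continuous map $f:Y\to X$ from a metrizable space $Y$ and every $y\in Y$ there is a neighborhood $U$ of $y$ in $Y$ such that the subspace $f(U)\subset X$ has a countable neighborhood base at $f(y)$. *)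

theory Defs
  imports "HOL-Analysis.Analysis" "HOL-Algebra.Group"
begin

definition quotient_open :: "'a topology \<Rightarrow> ('a \<Rightarrow> 'b) \<Rightarrow> 'b set \<Rightarrow> bool" where
  "quotient_open X q U \<longleftrightarrow> U \<subseteq> q ` topspace X \<and> openin X {x \<in> topspace X. q x \<in> U}"

lemma istopology_quotient_open: "istopology (quotient_open X q)"
  unfolding istopology_def
proof (intro conjI allI impI ballI)
  fix S T assume S: "quotient_open X q S" and T: "quotient_open X q T"
  have i: "{x \<in> topspace X. q x \<in> S \<inter> T} = {x \<in> topspace X. q x \<in> S} \<inter> {x \<in> topspace X. q x \<in> T}"
    by auto
  show "quotient_open X q (S \<inter> T)"
    using S T unfolding quotient_open_def i by (auto intro: openin_Int)
next
  fix K assume K: "\<forall>S\<in>K. quotient_open X q S"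
  have u: "{x \<in> topspace X. q x \<in> \<Union>K} = (\<Union>S\<in>K. {x \<in> topspace X. q x \<in> S})" by auto
  show "quotient_open X q (\<Union>K)"
    using K unfolding quotient_open_def u by (auto intro!: openin_Union)
qed

definition quotient_topology :: "'a topology \<Rightarrow> ('a \<Rightarrow> 'b) \<Rightarrow> 'b topology" where
  "quotient_topology X q = topology (quotient_open X q)"

definition dlim_open :: "'a topology \<Rightarrow> (nat \<Rightarrow> 'a set) \<Rightarrow> 'a set \<Rightarrow> bool" where
  "dlim_open X A U \<longleftrightarrow> U \<subseteq> (\<Union>p. A p) \<and> (\<forall>p. openin (subtopology X (A p)) (U \<inter> A p))"

lemma istopology_dlim_open: "istopology (dlim_open X A)"
  unfolding istopology_def
proof (intro conjI allI impI ballI)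
  fix S T assume S: "dlim_open X A S" and T: "dlim_open X A T"
  have i: "S \<inter> T \<inter> A p = (S \<inter> A p) \<inter> (T \<inter> A p)" for p by auto
  show "dlim_open X A (S \<inter> T)"
    using S T unfolding dlim_open_def i by (auto intro: openin_Int)
next
  fix K assume K: "\<forall>S\<in>K. dlim_open X A S"
  have u: "\<Union>K \<inter> A p = (\<Union>S\<in>K. S \<inter> A p)" for p by auto
  have "openin (subtopology X (A p)) (\<Union>K \<inter> A p)" for p
  proof -
    have "openin (subtopology X (A p)) (\<Union>S\<in>K. S \<inter> A p)"
      using K unfolding dlim_open_def by (intro openin_Union) auto
    then show ?thesis by (simp only: u)
  qed
  then show "dlim_open X A (\<Union>K)"
    using K unfolding dlim_open_def by blast
qed

definition direct_limit_topology :: "'a topology \<Rightarrow> (nat \<Rightarrow> 'a set) \<Rightarrow> 'a topology" where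
  "direct_limit_topology X A = topology (dlim_open X A)"

definition topological_group :: "('a, 'm) monoid_scheme \<Rightarrow> 'a topology \<Rightarrow> bool" where
  "topological_group G T \<longleftrightarrow> group G \<and> topspace T = carrier G \<and>
     continuous_map (prod_topology T T) T (\<lambda>(x, y). x \<otimes>\<^bsub>G\<^esub> y) \<and>
     continuous_map T T (\<lambda>x. inv\<^bsub>G\<^esub> x)"

definition countable_nbhd_base_at :: "'a topology \<Rightarrow> 'a \<Rightarrow> bool" where
  "countable_nbhd_base_at Z x \<longleftrightarrow>
     (\<exists>\<B>. countable \<B> \<and> (\<forall>B\<in>\<B>. openin Z B \<and> x \<in> B) \<and>
          (\<forall>U. openin Z U \<and> x \<in> U \<longrightarrow> (\<exists>B\<in>\<B>. B \<subseteq> U)))"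

definition property_M :: "'y itself \<Rightarrow> 'a topology \<Rightarrow> bool" where
  "property_M (_ :: 'y itself) X \<longleftrightarrow>
     (\<forall>(Y :: 'y topology) f y. metrizable_space Y \<and> continuous_map Y X f \<and> y \<in> topspace Y \<longrightarrow>
        (\<exists>U. (\<exists>V. openin Y V \<and> y \<in> V \<and> V \<subseteq> U) \<and> U \<subseteq> topspace Y \<and>
             countable_nbhd_base_at (subtopology X (f ` U)) (f y)))"

definition posnat :: "nat set" where "posnat = {n. 1 \<le> n}"

definition xpt :: "nat \<Rightarrow> nat \<Rightarrow> real \<times> real" where
  "xpt n m = (1 / real n, 1 / (real n * real m))"

definition Kset :: "(real \<times> real) set" where
  "Kset = {(0, 0)} \<union> {xpt n m | n m. n \<in> posnat \<and> m \<in> posnat}"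

definition Ktop :: "(real \<times> real) topology" where
  "Ktop = subtopology euclidean Kset"

definition S0 :: "real set" where
  "S0 = {0} \<union> {1 / real n | n. n \<in> posnat}"

definition NS0top :: "(nat \<times> real) topology" where
  "NS0top = prod_topology (discrete_topology posnat) (subtopology euclidean S0)"

definition Vq :: "nat \<times> real \<Rightarrow> nat \<times> real" where
  "Vq z = (if snd z = 0 then (0, 0) else z)"

definition Vtop :: "(nat \<times> real) topology" where
  "Vtop = quotient_topology NS0top Vq"

definition y0 :: "nat \<times> real" where "y0 = (0, 0)"

definition ypt :: "nat \<Rightarrow> nat \<Rightarrow> nat \<times> real" where
  "ypt n m = Vq (n, 1 / real m)"

definition z0 :: "(real \<times> real) \<times> (nat \<times> real)" where
  "z0 = ((0, 0), y0)"

definition z2 :: "nat \<Rightarrow> nat \<Rightarrow> (real \<times> real) \<times> (nat \<times> real)" where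
  "z2 n m = (xpt n m, y0)"

definition z4 :: "nat \<Rightarrow> nat \<Rightarrow> nat \<Rightarrow> nat \<Rightarrow> (real \<times> real) \<times> (nat \<times> real)" where
  "z4 n m p q = (xpt n m, ypt p (n + q))"

fun Wset :: "nat \<Rightarrow> ((real \<times> real) \<times> (nat \<times> real)) set" where
  "Wset 0 = {z0} \<union> {z2 n m | n m. n \<in> posnat \<and> m \<in> posnat}"
| "Wset (Suc p) = Wset p \<union> {z4 n m (Suc p) q | n m q. n \<in> posnat \<and> m \<in> posnat \<and> q \<in> posnat}"

definition Wtop :: "((real \<times> real) \<times> (nat \<times> real)) topology" where
  "Wtop = direct_limit_topology (prod_topology Ktop Vtop) Wset"

end

theory Submission
  imports Defs
begin

text \<open>
  Write \<open>a n m\<close> and \<open>b n m p q\<close> for the images in \<open>G\<close> of the points \<open>z2 n m\<close> and \<open>z4 n m p q\<close> of the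
  test space, and put \<open>c n m p q = inv (a n m) \<otimes> b n m p q\<close>. For fixed \<open>p\<close> these elements tend to \<open>\<one>\<close>
  as \<open>n\<close> grows, uniformly in \<open>m\<close> and \<open>q\<close>. Hence with \<open>\<one>\<close> they form a continuous image of a metrizable space
  with a single non-isolated point, and property M yields, for each coordinate \<open>k\<close>, a bound \<open>N p k\<close>
  beyond which the \<open>k\<close>-th coordinates of the \<open>c n m p q\<close> are first countable at the coordinate of \<open>\<one>\<close>.
  Take \<open>\<nu> p\<close> above \<open>p\<close> and above all \<open>N p k\<close> with \<open>k \<le> p\<close>. As also \<open>c n m p q\<close> tends to \<open>\<one>\<close> as \<open>q\<close>
  grows, there is \<open>Q m p\<close> such that \<open>c (\<nu> p) m p (Q m p)\<close> lies in the \<open>m\<close>-th basic set in all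
  coordinates \<open>k \<le> p\<close>. Removing the points \<open>z4 (\<nu> p) m p q\<close> with \<open>q \<le> Q m p\<close> from the test space leaves
  an open set, because only one value of \<open>n\<close> is affected for each \<open>p\<close>. It is the trace of an open
  subset of \<open>G\<close> containing a product of neighbourhoods of \<open>z0\<close> and \<open>\<one>\<close>. For large \<open>p\<close> and suitable \<open>m\<close>
  these contain \<open>a (\<nu> p) m\<close> and \<open>c (\<nu> p) m p (Q m p)\<close>, whose product \<open>b (\<nu> p) m p (Q m p)\<close> was removed.
\<close>

section \<open>Property M and families converging uniformly to a point\<close>

text \<open>The values \<open>g n j\<close> and \<open>x\<close> are the image of a countable metric
  space with one limit point, and \<open>lim\<close> is continuity there. Its points are coded as
  constant sequences because property M is tested on spaces of type
  \<open>nat \<Rightarrow> real\<close>. The neighbourhood given by property M contains a ball,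
  hence all levels \<open>n \<ge> N\<close>. A base in the image subspace lifts to open sets of
  \<open>X\<close> that are compared only on the values \<open>g n j\<close>.\<close>

lemma property_M_uniform_limit:
  fixes X :: "'b topology" and g :: "nat \<Rightarrow> nat \<Rightarrow> 'b"
  assumes M: "property_M TYPE(nat \<Rightarrow> real) X" and x: "x \<in> topspace X"
    and g: "\<And>n j. g n j \<in> topspace X"
    and lim: "\<And>U. openin X U \<Longrightarrow> x \<in> U \<Longrightarrow> \<exists>N. \<forall>n\<ge>N. \<forall>j. g n j \<in> U"
  shows "\<exists>N B. decseq B \<and> (\<forall>i::nat. openin X (B i) \<and> x \<in> B i) \<and>
    (\<forall>U. openin X U \<and> x \<in> U \<longrightarrow> (\<exists>i. \<forall>n\<ge>N. \<forall>j. g n j \<in> B i \<longrightarrow> g n j \<in> U))"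
proof -
  \<comment> \<open>\<open>D 0\<close> is the limit point; \<open>c n j\<close> is isolated, at distance \<open>1 / Suc n\<close> from \<open>D 0\<close>.\<close>
  define D :: "nat \<Rightarrow> nat \<Rightarrow> real" where "D k = (\<lambda>_. real k)" for k
  have injD: "D k = D l \<longleftrightarrow> k = l" for k l
    by (auto simp: D_def fun_eq_iff)
  define c where "c n j = D (Suc (prod_encode (n, j)))" for n j
  define k where "k y = nat \<lfloor>y 0\<rfloor>" for y :: "nat \<Rightarrow> real"
  have kD [simp]: "k (D i) = i" for i by (simp add: k_def D_def)
  define r where "r y = (case k y of 0 \<Rightarrow> 0 | Suc t \<Rightarrow> 1 / real (Suc (fst (prod_decode t))))" for y
  define f where "f y = (case k y of 0 \<Rightarrow> x | Suc t \<Rightarrow> case_prod g (prod_decode t))" for y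
  have r0: "r (D 0) = 0" and rc: "r (c n j) = 1 / real (Suc n)" for n j
    by (simp_all add: r_def c_def)
  have f0: "f (D 0) = x" and fc: "f (c n j) = g n j" for n j
    by (simp_all add: f_def c_def)
  have range: "y = D 0 \<or> (\<exists>n j. y = c n j)" if y: "y \<in> range D" for y
  proof -
    obtain i where i: "y = D i" using y by auto
    show ?thesis
    proof (cases i)
      case (Suc t)
      have "prod_encode (fst (prod_decode t), snd (prod_decode t)) = t" by simp
      then show ?thesis unfolding i Suc c_def by metis
    qed (simp add: i)
  qed
  have cne: "c n j \<noteq> D 0" for n j by (simp add: c_def injD)
  \<comment> \<open>Distinct points are as far apart as the larger of their heights
    \<open>r\<close>. Only \<open>D 0\<close> has height 0, so every other point is
    isolated.\<close>
  define d where "d y z = (if y = z then 0 else max (r y) (r z))" for y z :: "nat \<Rightarrow> real"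
  have rnn: "r y \<ge> 0" for y by (auto simp: r_def split: nat.splits)
  have rpos: "r y > 0" if "y \<in> range D" "y \<noteq> D 0" for y
    using range[OF that(1)] that(2) rc by auto
  interpret Metric_space "range D" d
  proof
    show "0 \<le> d y z" for y z by (auto simp: d_def rnn le_max_iff_disj)
    show "d y z = d z y" for y z by (auto simp: d_def)
    show "d y z = 0 \<longleftrightarrow> y = z" if "y \<in> range D" "z \<in> range D" for y z
    proof (cases "y = z")
      case False
      then have "r y > 0 \<or> r z > 0" using rpos that by metis
      then show ?thesis using False by (auto simp: d_def max_def not_le split: if_splits)
    qed (simp add: d_def)
    show "d u z \<le> d u y + d y z" for u y z
      using rnn[of u] rnn[of y] rnn[of z] by (auto simp: d_def max_def)
  qed
  have ball0: "c n j \<in> mball (D 0) e" if "1 / real (Suc n) < e" for n j e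
  proof -
    have "d (D 0) (c n j) = 1 / real (Suc n)"
      using cne[of n j] by (auto simp: d_def r0 rc)
    then show ?thesis using that by (simp add: c_def)
  qed
  have ballc: "mball (c n j) (1 / real (Suc n)) \<subseteq> {c n j}" for n j
  proof
    fix z assume z: "z \<in> mball (c n j) (1 / real (Suc n))"
    then have "d (c n j) z < 1 / real (Suc n)" by simp
    then show "z \<in> {c n j}" by (simp add: d_def rc split: if_splits)
  qed
  have fY: "f y \<in> topspace X" if "y \<in> range D" for y
    using range[OF that] g x f0 fc by auto
  have cont: "continuous_map mtopology X f"
    unfolding continuous_map_def
  proof (intro conjI allI impI)
    show "f \<in> topspace mtopology \<rightarrow> topspace X" using fY by auto
  next
    fix U assume U: "openin X U"
    show "openin mtopology {y \<in> topspace mtopology. f y \<in> U}"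
      unfolding openin_mtopology
    proof (intro conjI allI impI)
      fix y assume "y \<in> {y \<in> topspace mtopology. f y \<in> U}"
      then have y: "y \<in> range D" "f y \<in> U" by auto
      from range[OF y(1)] show "\<exists>e>0. mball y e \<subseteq> {y \<in> topspace mtopology. f y \<in> U}"
      proof
        assume y0: "y = D 0"
        then obtain N where N: "\<And>n j. n \<ge> N \<Longrightarrow> g n j \<in> U"
          using lim[OF U] y(2) f0 by metis
        have "z \<in> {y \<in> topspace mtopology. f y \<in> U}" if z: "z \<in> mball y (1 / real (Suc N))" for z
        proof -
          have zr: "z \<in> range D" using z by simp
          from range[OF zr] have "f z \<in> U"
          proof
            assume "z = D 0" then show ?thesis using y0 y by simp
          next
            assume "\<exists>n j. z = c n j"
            then obtain n j where zc: "z = c n j" by auto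
            have "r z < 1 / real (Suc N)"
              using z cne[of n j] unfolding zc y0 by (auto simp: d_def split: if_splits)
            then have "n \<ge> N" by (simp add: zc rc field_simps)
            then show ?thesis using N zc fc by simp
          qed
          then show ?thesis using zr by simp
        qed
        then show ?thesis by (intro exI[of _ "1 / real (Suc N)"]) auto
      next
        assume "\<exists>n j. y = c n j"
        then obtain n j where "y = c n j" by auto
        then show ?thesis using ballc[of n j] y by (intro exI[of _ "1 / real (Suc n)"]) auto
      qed
    qed auto
  qed
  have "D 0 \<in> topspace mtopology" by simp
  with M cont metrizable_space_mtopology obtain U V where
    V: "openin mtopology V" "D 0 \<in> V" "V \<subseteq> U"
    and cb: "countable_nbhd_base_at (subtopology X (f ` U)) (f (D 0))"
    unfolding property_M_def by metis
  obtain e where e: "e > 0" "mball (D 0) e \<subseteq> V" using V unfolding openin_mtopology by blast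
  obtain N where N: "1 / real (Suc N) < e"
    using e(1) nat_approx_posE by blast
  have gU: "g n j \<in> f ` U" if "n \<ge> N" for n j
  proof -
    have "1 / real (Suc n) \<le> 1 / real (Suc N)" using that by (simp add: field_simps)
    then have "c n j \<in> mball (D 0) e" using ball0[of n e j] N by linarith
    then have "c n j \<in> U" using e V by blast
    then show ?thesis using fc by (metis imageI)
  qed
  obtain \<B> where \<B>: "countable \<B>" "\<And>B. B \<in> \<B> \<Longrightarrow> openin (subtopology X (f ` U)) B \<and> x \<in> B"
    "\<And>W. openin (subtopology X (f ` U)) W \<Longrightarrow> x \<in> W \<Longrightarrow> \<exists>B\<in>\<B>. B \<subseteq> W"
    using cb unfolding countable_nbhd_base_at_def f0 by metis
  have xU: "x \<in> f ` U" using V f0 by (metis imageI subsetD)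
  \<comment> \<open>The base must be nonempty for \<open>from_nat_into\<close> to enumerate
    it.\<close>
  have "\<exists>B\<in>\<B>. B \<subseteq> topspace (subtopology X (f ` U))"
    using \<B>(3) x xU by (metis Int_iff openin_topspace topspace_subtopology)
  then have ne: "\<B> \<noteq> {}" by auto
  define C where "C = from_nat_into \<B>"
  have "\<forall>i. \<exists>S. openin X S \<and> C i = S \<inter> f ` U"
    using \<B>(2) from_nat_into[OF ne] unfolding C_def openin_subtopology by metis
  then obtain S where S: "\<And>i. openin X (S i)" "\<And>i. C i = S i \<inter> f ` U" by metis
  \<comment> \<open>Finite intersections make the sequence decreasing, and \<open>B i\<close> still
    lies inside \<open>S i\<close>, whose trace is the basic set \<open>C i\<close>.\<close>
  define B where "B i = (\<Inter>l\<le>i. S l)" for i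
  have xS: "x \<in> S i" for i using \<B>(2) from_nat_into[OF ne, of i] S(2)[of i] unfolding C_def by auto
  show ?thesis
  proof (rule exI[of _ N], rule exI[of _ B], intro conjI allI impI)
    show "decseq B" unfolding B_def decseq_def by auto
    show "openin X (B i)" for i unfolding B_def using S(1) by (intro openin_INT2) auto
    show "x \<in> B i" for i using xS by (auto simp: B_def)
    fix O' assume O': "openin X O' \<and> x \<in> O'"
    then have "openin (subtopology X (f ` U)) (O' \<inter> f ` U)" "x \<in> O' \<inter> f ` U"
      using xU by (auto simp: openin_subtopology)
    then obtain b where b: "b \<in> \<B>" "b \<subseteq> O' \<inter> f ` U" using \<B>(3) by metis
    obtain i where i: "C i = b" using b(1) \<B>(1) unfolding C_def by (metis from_nat_into_surj)
    show "\<exists>i. \<forall>n\<ge>N. \<forall>j. g n j \<in> B i \<longrightarrow> g n j \<in> O'"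
      using gU i b S(2)[of i] by (intro exI[of _ i]) (auto simp: B_def)
  qed
qed

section \<open>Neighbourhoods in topological groups and in subspaces of products\<close>

lemma topological_group_mult_nbhd:
  assumes "topological_group G T" "x \<in> carrier G" "y \<in> carrier G" "openin T U" "x \<otimes>\<^bsub>G\<^esub> y \<in> U"
  obtains A B where "openin T A" "openin T B" "x \<in> A" "y \<in> B"
    "\<And>a b. a \<in> A \<Longrightarrow> b \<in> B \<Longrightarrow> a \<otimes>\<^bsub>G\<^esub> b \<in> U"
proof -
  have c: "continuous_map (prod_topology T T) T (\<lambda>(x, y). x \<otimes>\<^bsub>G\<^esub> y)" and ts: "topspace T = carrier G"
    using assms(1) by (auto simp: topological_group_def)
  have "openin (prod_topology T T) {z \<in> topspace (prod_topology T T). (\<lambda>(x, y). x \<otimes>\<^bsub>G\<^esub> y) z \<in> U}"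
    by (rule openin_continuous_map_preimage[OF c assms(4)])
  moreover have "(x, y) \<in> {z \<in> topspace (prod_topology T T). (\<lambda>(x, y). x \<otimes>\<^bsub>G\<^esub> y) z \<in> U}"
    using assms ts by simp
  ultimately obtain A B where "openin T A" "openin T B" "x \<in> A" "y \<in> B"
    "A \<times> B \<subseteq> {z \<in> topspace (prod_topology T T). (\<lambda>(x, y). x \<otimes>\<^bsub>G\<^esub> y) z \<in> U}"
    unfolding openin_prod_topology_alt by meson
  then show ?thesis by (intro that[of A B]) auto
qed

lemma topological_group_inv_mult_nbhd:
  assumes G: "topological_group G T" and "x \<in> carrier G" "y \<in> carrier G" "openin T U"
    and "inv\<^bsub>G\<^esub> x \<otimes>\<^bsub>G\<^esub> y \<in> U"
  obtains A B where "openin T A" "openin T B" "x \<in> A" "y \<in> B"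
    "\<And>a b. a \<in> A \<Longrightarrow> b \<in> B \<Longrightarrow> inv\<^bsub>G\<^esub> a \<otimes>\<^bsub>G\<^esub> b \<in> U"
proof -
  have c: "continuous_map T T (\<lambda>x. inv\<^bsub>G\<^esub> x)" and ts: "topspace T = carrier G" and gr: "group G"
    using G by (auto simp: topological_group_def)
  obtain A B where AB: "openin T A" "openin T B" "inv\<^bsub>G\<^esub> x \<in> A" "y \<in> B"
    "\<And>a b. a \<in> A \<Longrightarrow> b \<in> B \<Longrightarrow> a \<otimes>\<^bsub>G\<^esub> b \<in> U"
    using topological_group_mult_nbhd[OF G _ assms(3,4,5)] assms(2) gr by (metis group.inv_closed)
  have "openin T {z \<in> topspace T. inv\<^bsub>G\<^esub> z \<in> A}"
    by (rule openin_continuous_map_preimage[OF c AB(1)])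
  then show ?thesis using AB assms(2) ts
    by (intro that[of "{z \<in> topspace T. inv\<^bsub>G\<^esub> z \<in> A}" B]) auto
qed

text \<open>A basic open box restricts only finitely many coordinates, and \<open>K\<close> bounds
  them. An initial segment of coordinates, rather than an arbitrary finite set, suits the later
  diagonal choice over \<open>k \<le> p\<close>.\<close>

lemma subspace_of_product_nbhd:
  fixes X :: "nat \<Rightarrow> 'b topology"
  assumes "homeomorphic_map T (subtopology (product_topology X UNIV) S) \<phi>" "openin T U" "x \<in> U"
  obtains K B where "\<And>k. openin (X k) (B k)" "\<And>k. \<phi> x k \<in> B k"
    "\<And>y. y \<in> topspace T \<Longrightarrow> (\<And>k. k \<le> K \<Longrightarrow> \<phi> y k \<in> B k) \<Longrightarrow> y \<in> U"
proof -
  let ?P = "product_topology X UNIV"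
  have Ut: "U \<subseteq> topspace T" using assms(2) openin_subset by blast
  have inj: "inj_on \<phi> (topspace T)" and im: "\<phi> ` topspace T = topspace (subtopology ?P S)"
    using assms(1) by (simp_all only: homeomorphic_eq_everything_map)
  have "openin (subtopology ?P S) (\<phi> ` U)"
    using homeomorphic_map_openness[OF assms(1) Ut] assms(2) by simp
  then obtain O' where O': "openin ?P O'" "\<phi> ` U = O' \<inter> S" unfolding openin_subtopology by auto
  have "\<phi> x \<in> O'" using O' assms(3) by auto
  then obtain B where B: "\<phi> x \<in> Pi\<^sub>E UNIV B" "\<And>i. openin (X i) (B i)"
     "finite {i. B i \<noteq> topspace (X i)}" "Pi\<^sub>E UNIV B \<subseteq> O'"
    using product_topology_open_contains_basis[OF O'(1)] by metis
  obtain K where K: "{i. B i \<noteq> topspace (X i)} \<subseteq> {..K}"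
    using B(3) finite_nat_iff_bounded_le by auto
  show ?thesis
  proof (rule that[of B K])
    show "openin (X k) (B k)" "\<phi> x k \<in> B k" for k using B by auto
    fix y assume y: "y \<in> topspace T" "\<And>k. k \<le> K \<Longrightarrow> \<phi> y k \<in> B k"
    have yt: "\<phi> y \<in> topspace ?P \<inter> S" using im y(1) by auto
    have "\<phi> y k \<in> B k" for k
    proof (cases "k \<le> K")
      case False
      then have "B k = topspace (X k)" using K by auto
      then show ?thesis using yt by auto
    qed (use y in auto)
    then have "\<phi> y \<in> O' \<inter> S" using B(4) yt by auto
    then obtain u where "u \<in> U" "\<phi> y = \<phi> u" using O'(2) by (metis imageE)
    then show "y \<in> U" using inj y(1) Ut by (metis inj_onD subsetD)
  qed
qed

section \<open>The contradiction in the group\<close>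

text \<open>The group argument needs only four features of the test space: the three convergences
  and, in \<open>sep\<close>, the removal of finitely many \<open>q\<close> for each
  \<open>m\<close> and \<open>p\<close> at the single level \<open>\<nu> p\<close>. Since
  \<open>sep\<close> allows arbitrary \<open>\<nu>\<close> and \<open>Q\<close>, these can be chosen
  after property M has been applied.\<close>

lemma topological_group_not_in_product:
  fixes G :: "('a, 'm) monoid_scheme" and T :: "'a topology"
    and X :: "nat \<Rightarrow> 'b topology" and a :: "nat \<Rightarrow> nat \<Rightarrow> 'a"
    and b :: "nat \<Rightarrow> nat \<Rightarrow> nat \<Rightarrow> nat \<Rightarrow> 'a"
  assumes G: "topological_group G T" and M: "\<And>k. property_M TYPE(nat \<Rightarrow> real) (X k)"
    and mem: "a0 \<in> carrier G" "\<And>n m. a n m \<in> carrier G" "\<And>n m p q. b n m p q \<in> carrier G"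
    and a_lim: "\<And>U. openin T U \<Longrightarrow> a0 \<in> U \<Longrightarrow> \<exists>N. \<forall>n\<ge>N. \<forall>m. a n m \<in> U"
    and b_lim: "\<And>U p. openin T U \<Longrightarrow> a0 \<in> U \<Longrightarrow> \<exists>N. \<forall>n\<ge>N. \<forall>m q. b n m p q \<in> U"
    and b_lim_a: "\<And>U n m p. openin T U \<Longrightarrow> a n m \<in> U \<Longrightarrow> \<exists>R. \<forall>q\<ge>R. b n m p q \<in> U"
    and sep: "\<And>\<nu> Q. \<exists>U. openin T U \<and> a0 \<in> U \<and> (\<forall>m p q. b (\<nu> p) m p q \<in> U \<longrightarrow> Q m p \<le> q)"
    and \<phi>: "homeomorphic_map T (subtopology (product_topology X UNIV) S) \<phi>"
  shows False
proof -
  interpret group G using G by (simp add: topological_group_def)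
  have ts: "topspace T = carrier G" using G by (simp add: topological_group_def)
  define c where "c n m p q = inv\<^bsub>G\<^esub> (a n m) \<otimes>\<^bsub>G\<^esub> b n m p q" for n m p q
  have cG: "c n m p q \<in> carrier G" for n m p q using mem by (simp add: c_def)
  have bc: "b n m p q = a n m \<otimes>\<^bsub>G\<^esub> c n m p q" for n m p q
    using mem by (simp add: c_def flip: m_assoc)
  \<comment> \<open>Both families tend to \<open>a0\<close> uniformly, and the inverse of
    \<open>a0\<close> times \<open>a0\<close> is \<open>\<one>\<close>.\<close>
  have c_lim: "\<exists>N. \<forall>n\<ge>N. \<forall>m q. c n m p q \<in> U" if U: "openin T U" "\<one>\<^bsub>G\<^esub> \<in> U" for U p
  proof -
    obtain A B where AB: "openin T A" "openin T B" "a0 \<in> A" "a0 \<in> B"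
      "\<And>a b. a \<in> A \<Longrightarrow> b \<in> B \<Longrightarrow> inv\<^bsub>G\<^esub> a \<otimes>\<^bsub>G\<^esub> b \<in> U"
      using topological_group_inv_mult_nbhd[OF G mem(1) mem(1) U(1)] U mem by auto
    obtain N1 where "\<forall>n\<ge>N1. \<forall>m. a n m \<in> A" using a_lim AB by blast
    moreover obtain N2 where "\<forall>n\<ge>N2. \<forall>m q. b n m p q \<in> B" using b_lim AB by blast
    ultimately show ?thesis using AB(5) unfolding c_def by (intro exI[of _ "max N1 N2"]) auto
  qed
  \<comment> \<open>The same continuity argument at \<open>a n m\<close> instead of
    \<open>a0\<close>, with the first factor constant.\<close>
  have c_lim_q: "\<exists>q. c n m p q \<in> U" if U: "openin T U" "\<one>\<^bsub>G\<^esub> \<in> U" for U n m p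
  proof -
    obtain A B where AB: "openin T A" "openin T B" "a n m \<in> A" "a n m \<in> B"
      "\<And>a b. a \<in> A \<Longrightarrow> b \<in> B \<Longrightarrow> inv\<^bsub>G\<^esub> a \<otimes>\<^bsub>G\<^esub> b \<in> U"
      using topological_group_inv_mult_nbhd[OF G mem(2) mem(2) U(1)] U mem by (metis l_inv)
    then show ?thesis using b_lim_a[OF AB(2,4), of p] unfolding c_def by blast
  qed
  have cont: "continuous_map T (X k) (\<lambda>y. \<phi> y k)" for k
  proof -
    have "continuous_map T (product_topology X UNIV) \<phi>"
      using \<phi> homeomorphic_imp_continuous_map continuous_map_in_subtopology by blast
    then show ?thesis by (simp add: continuous_map_componentwise_UNIV)
  qed
  have pre: "openin T {y \<in> topspace T. \<phi> y k \<in> U}" if "openin (X k) U" for k U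
    using openin_continuous_map_preimage[OF cont that] .
  have tX: "\<phi> y k \<in> topspace (X k)" if "y \<in> carrier G" for y k
    using cont that ts unfolding continuous_map_def by (auto simp: Pi_iff)
  \<comment> \<open>The pair \<open>(m, q)\<close> is coded as one index \<open>j\<close>, over
    which the convergence in \<open>n\<close> is uniform.\<close>
  let ?g = "\<lambda>p k n j. \<phi> (c n (fst (prod_decode j)) p (snd (prod_decode j))) k"
  have "\<exists>N B. decseq B \<and> (\<forall>i::nat. openin (X k) (B i) \<and> \<phi> \<one>\<^bsub>G\<^esub> k \<in> B i) \<and>
    (\<forall>U. openin (X k) U \<and> \<phi> \<one>\<^bsub>G\<^esub> k \<in> U \<longrightarrow> (\<exists>i. \<forall>n\<ge>N. \<forall>j. ?g p k n j \<in> B i \<longrightarrow> ?g p k n j \<in> U))"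
    for p k
  proof (rule property_M_uniform_limit[OF M])
    fix U assume U: "openin (X k) U" "\<phi> \<one>\<^bsub>G\<^esub> k \<in> U"
    have "\<exists>N. \<forall>n\<ge>N. \<forall>m q. c n m p q \<in> {y \<in> topspace T. \<phi> y k \<in> U}"
      using U ts by (intro c_lim pre) auto
    then show "\<exists>N. \<forall>n\<ge>N. \<forall>j. ?g p k n j \<in> U" by blast
  qed (use tX cG in auto)
  then obtain N B where NB: "\<And>p k. decseq (B p k)" "\<And>p k i. openin (X k) (B p k (i::nat))"
     "\<And>p k i. \<phi> \<one>\<^bsub>G\<^esub> k \<in> B p k i"
     "\<And>p k U. openin (X k) U \<Longrightarrow> \<phi> \<one>\<^bsub>G\<^esub> k \<in> U \<Longrightarrow>
        \<exists>i. \<forall>n\<ge>N p k. \<forall>j. ?g p k n j \<in> B p k i \<longrightarrow> ?g p k n j \<in> U"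
    by metis
  have B': "\<exists>i. \<forall>n\<ge>N p k. \<forall>m q. \<phi> (c n m p q) k \<in> B p k i \<longrightarrow> \<phi> (c n m p q) k \<in> U"
    if U: "openin (X k) U" "\<phi> \<one>\<^bsub>G\<^esub> k \<in> U" for p k U
  proof -
    obtain i where i: "\<And>n j. n \<ge> N p k \<Longrightarrow> ?g p k n j \<in> B p k i \<Longrightarrow> ?g p k n j \<in> U"
      using NB(4)[OF U, of p] by metis
    show ?thesis using i[of _ "prod_encode (_, _)"] by (intro exI[of _ i]) simp
  qed
  \<comment> \<open>The sum dominates each \<open>N p k\<close> with \<open>k \<le> p\<close>; the
    summand \<open>p\<close> makes \<open>\<nu> p\<close> unbounded, so that
    \<open>a (\<nu> p) m\<close> eventually enters any neighbourhood of \<open>a0\<close>.\<close>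
  define \<nu> where "\<nu> p = p + (\<Sum>k\<le>p. N p k)" for p
  have \<nu>: "\<nu> p \<ge> p" "k \<le> p \<Longrightarrow> \<nu> p \<ge> N p k" for p k
    unfolding \<nu>_def using member_le_sum[of k "{..p}" "N p"] by auto
  \<comment> \<open>The index \<open>m\<close> of the point is also the index of the basic set, so a
    later choice of \<open>m\<close> reaches arbitrarily small basic sets. Only finitely many
    coordinates are constrained, hence one neighbourhood of \<open>\<one>\<close> suffices.\<close>
  have "\<exists>q. \<forall>k\<le>p. \<phi> (c (\<nu> p) m p q) k \<in> B p k m" for m p
  proof -
    have "openin T (\<Inter>k\<in>{..p}. {y \<in> topspace T. \<phi> y k \<in> B p k m})"
      using pre NB(2) by (intro openin_INT2) auto
    from c_lim_q[OF this, of "\<nu> p" m p] show ?thesis using NB(3) ts by auto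
  qed
  then have "\<exists>Q. \<forall>m p. \<forall>k\<le>p. \<phi> (c (\<nu> p) m p (Q m p)) k \<in> B p k m"
    by (intro choice allI)
  then obtain Q where Q: "\<And>m p k. k \<le> p \<Longrightarrow> \<phi> (c (\<nu> p) m p (Q m p)) k \<in> B p k m" by blast
  \<comment> \<open>The successor ensures that the point with \<open>q = Q m p\<close> itself is
    excluded from \<open>U\<close>.\<close>
  obtain U where U: "openin T U" "a0 \<in> U" "\<And>m p q. b (\<nu> p) m p q \<in> U \<Longrightarrow> Suc (Q m p) \<le> q"
    using sep[of \<nu> "\<lambda>m p. Suc (Q m p)"] by auto
  obtain A E where AE: "openin T A" "openin T E" "a0 \<in> A" "\<one>\<^bsub>G\<^esub> \<in> E"
    "\<And>a b. a \<in> A \<Longrightarrow> b \<in> E \<Longrightarrow> a \<otimes>\<^bsub>G\<^esub> b \<in> U"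
    using topological_group_mult_nbhd[OF G mem(1) one_closed U(1)] U mem by auto
  obtain L where L: "\<And>n m. n \<ge> L \<Longrightarrow> a n m \<in> A" using a_lim AE by metis
  obtain K D where D: "\<And>k. openin (X k) (D k)" "\<And>k. \<phi> \<one>\<^bsub>G\<^esub> k \<in> D k"
    "\<And>y. y \<in> topspace T \<Longrightarrow> (\<And>k. k \<le> K \<Longrightarrow> \<phi> y k \<in> D k) \<Longrightarrow> y \<in> E"
    using subspace_of_product_nbhd[OF \<phi> AE(2,4)] by metis
  \<comment> \<open>\<open>L\<close> brings \<open>a (\<nu> p) m\<close> into \<open>A\<close>,
    since \<open>\<nu> p \<ge> p\<close>; \<open>K\<close> ensures that \<open>Q\<close> controls
    every coordinate that matters for \<open>E\<close>.\<close>
  define p where "p = max L K"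
  have "\<exists>i. \<forall>n\<ge>N p k. \<forall>m q. \<phi> (c n m p q) k \<in> B p k i \<longrightarrow> \<phi> (c n m p q) k \<in> D k" for k
    using B' D by blast
  then obtain i where i: "\<And>k n m q. n \<ge> N p k \<Longrightarrow> \<phi> (c n m p q) k \<in> B p k (i k) \<Longrightarrow> \<phi> (c n m p q) k \<in> D k"
    by metis
  \<comment> \<open>The sum is at least each \<open>i k\<close>, so by monotonicity the
    \<open>m\<close>-th basic set is small enough in all coordinates \<open>k \<le> p\<close> at
    once.\<close>
  define m where "m = (\<Sum>k\<le>p. i k)"
  have "\<phi> (c (\<nu> p) m p (Q m p)) k \<in> D k" if "k \<le> K" for k
  proof (rule i)
    have kp: "k \<le> p" using that by (simp add: p_def)
    show "N p k \<le> \<nu> p" using \<nu>(2) kp by blast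
    have "i k \<le> m" unfolding m_def using kp by (intro member_le_sum) auto
    then have "B p k m \<subseteq> B p k (i k)" using NB(1) by (simp add: decseq_def)
    then show "\<phi> (c (\<nu> p) m p (Q m p)) k \<in> B p k (i k)" using Q[OF kp, of m] by auto
  qed
  then have "c (\<nu> p) m p (Q m p) \<in> E" using D(3) cG ts by auto
  moreover have "a (\<nu> p) m \<in> A" using L \<nu>(1)[of p] by (simp add: p_def)
  ultimately have "b (\<nu> p) m p (Q m p) \<in> U" using AE(5) bc by auto
  then show False using U(3) by fastforce
qed

section \<open>Open sets and points of the test space\<close>

lemma openin_direct_limit_topology: "openin (direct_limit_topology X A) U \<longleftrightarrow> dlim_open X A U"
  by (simp add: direct_limit_topology_def istopology_dlim_open topology_inverse')

lemma openin_quotient_topology: "openin (quotient_topology X q) U \<longleftrightarrow> quotient_open X q U"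
  by (simp add: quotient_topology_def istopology_quotient_open topology_inverse')

lemma topspace_direct_limit_topology:
  assumes "\<And>p. A p \<subseteq> topspace X"
  shows "topspace (direct_limit_topology X A) = (\<Union>p. A p)"
proof -
  have "(\<Union>q. A q) \<inter> A p = A p" for p by auto
  moreover have "openin (subtopology X (A p)) (A p)" for p
    using assms[of p] by (metis openin_topspace topspace_subtopology_subset)
  ultimately have "openin (direct_limit_topology X A) (\<Union>p. A p)"
    by (simp add: openin_direct_limit_topology dlim_open_def)
  moreover have "U \<subseteq> (\<Union>p. A p)" if "openin (direct_limit_topology X A) U" for U
    using that by (simp add: openin_direct_limit_topology dlim_open_def)
  ultimately show ?thesis unfolding topspace_def by blast
qed

lemma topspace_quotient_topology: "topspace (quotient_topology X q) = q ` topspace X"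
proof -
  have "{x \<in> topspace X. q x \<in> q ` topspace X} = topspace X" by auto
  then have "openin (quotient_topology X q) (q ` topspace X)"
    by (simp add: openin_quotient_topology quotient_open_def)
  moreover have "U \<subseteq> q ` topspace X" if "openin (quotient_topology X q) U" for U
    using that by (simp add: openin_quotient_topology quotient_open_def)
  ultimately show ?thesis unfolding topspace_def by blast
qed

lemma Suc_posnat [simp]: "Suc n \<in> posnat"
  by (simp add: posnat_def)

lemma topspace_Ktop: "topspace Ktop = Kset"
  by (simp add: Ktop_def)

lemma topspace_NS0top: "topspace NS0top = posnat \<times> S0"
  by (simp add: NS0top_def)

lemma topspace_Vtop: "topspace Vtop = Vq ` (posnat \<times> S0)"
  by (simp add: Vtop_def topspace_quotient_topology topspace_NS0top)

lemma openin_Vtop: "openin Vtop U \<longleftrightarrow> U \<subseteq> topspace Vtop \<and> openin NS0top {x \<in> posnat \<times> S0. Vq x \<in> U}"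
  by (simp add: Vtop_def openin_quotient_topology quotient_open_def topspace_quotient_topology
      topspace_NS0top)

lemma xpt_in_Kset [simp]: "xpt (Suc n) (Suc m) \<in> Kset"
  unfolding Kset_def using Suc_posnat by blast

lemma ypt_eq: "ypt p (Suc r) = (p, 1 / real (Suc r))"
  by (simp add: ypt_def Vq_def)

lemma y0_in_Vtop: "y0 \<in> topspace Vtop"
proof -
  have "(1, 0) \<in> posnat \<times> S0" by (simp add: posnat_def S0_def)
  moreover have "Vq (1, 0) = y0" by (simp add: Vq_def y0_def)
  ultimately show ?thesis unfolding topspace_Vtop by (metis imageI)
qed

lemma S0_inverse_Suc: "1 / real (Suc r) \<in> S0"
proof -
  have "Suc r \<in> posnat" by simp
  then show ?thesis unfolding S0_def by blast
qed

lemma ypt_in_Vtop: "ypt (Suc p) (Suc r) \<in> topspace Vtop"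
  unfolding topspace_Vtop ypt_def using S0_inverse_Suc[of r] by (intro imageI) simp

lemma Wset_subset: "Wset p \<subseteq> topspace (prod_topology Ktop Vtop)"
proof (induction p)
  case 0
  have "(0, 0) \<in> Kset" by (simp add: Kset_def)
  moreover have "xpt n m \<in> Kset" if "n \<in> posnat" "m \<in> posnat" for n m
    using that by (auto simp: Kset_def)
  ultimately show ?case using y0_in_Vtop by (auto simp: z0_def z2_def topspace_Ktop)
next
  case (Suc p)
  have "z4 n m (Suc p) q \<in> topspace (prod_topology Ktop Vtop)"
    if nmq: "n \<in> posnat" "m \<in> posnat" "q \<in> posnat" for n m q
  proof -
    have "xpt n m \<in> Kset" using nmq by (auto simp: Kset_def)
    moreover have "n + q = Suc (n + q - 1)" using nmq by (simp add: posnat_def)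
    ultimately show ?thesis using ypt_in_Vtop[of p "n + q - 1"] by (simp add: z4_def topspace_Ktop)
  qed
  then show ?case using Suc unfolding Wset.simps by blast
qed

lemma topspace_Wtop: "topspace Wtop = (\<Union>p. Wset p)"
  unfolding Wtop_def by (rule topspace_direct_limit_topology[OF Wset_subset])

lemma openin_Wtop: "openin Wtop U \<longleftrightarrow>
    U \<subseteq> topspace Wtop \<and> (\<forall>p. openin (subtopology (prod_topology Ktop Vtop) (Wset p)) (U \<inter> Wset p))"
  unfolding topspace_Wtop by (simp add: Wtop_def openin_direct_limit_topology dlim_open_def)

lemma z0_in_Wset: "z0 \<in> Wset p"
  by (induction p) auto

lemma z2_in_Wset: "z2 (Suc n) (Suc m) \<in> Wset p"
proof (induction p)
  case 0
  then show ?case unfolding Wset.simps using Suc_posnat by blast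
qed simp

lemma z4_in_Wset: "z4 (Suc n) (Suc m) (Suc p) (Suc q) \<in> Wset (Suc p)"
proof -
  have "Suc n \<in> posnat" "Suc m \<in> posnat" "Suc q \<in> posnat" by auto
  then show ?thesis unfolding Wset.simps by blast
qed

lemma z_in_Wtop [simp]:
  "z0 \<in> topspace Wtop" "z2 (Suc n) (Suc m) \<in> topspace Wtop"
  "z4 (Suc n) (Suc m) (Suc p) (Suc q) \<in> topspace Wtop"
  unfolding topspace_Wtop
  by (rule UN_I[OF UNIV_I], rule z0_in_Wset z2_in_Wset z4_in_Wset)+

section \<open>Convergence in the test space\<close>

text \<open>Both coordinates are at most \<open>1 / Suc n\<close>, so whole columns shrink to the
  origin, uniformly in \<open>m\<close>.\<close>

lemma xpt_tendsto:
  assumes "openin Ktop A" "(0, 0) \<in> A"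
  shows "\<exists>N. \<forall>n\<ge>N. \<forall>m. xpt (Suc n) (Suc m) \<in> A"
proof -
  obtain B where B: "open B" "A = B \<inter> Kset"
    using assms(1) unfolding Ktop_def openin_subtopology by auto
  obtain e where e: "e > 0" "ball (0, 0) e \<subseteq> B"
    using B assms(2) by (metis Int_iff open_contains_ball)
  obtain N where N: "1 / real (Suc N) < e / 2" using e(1) nat_approx_posE half_gt_zero by metis
  have "xpt (Suc n) (Suc m) \<in> A" if n: "n \<ge> N" for n m
  proof -
    have 1: "1 / real (Suc n) < e / 2"
    proof -
      have "1 / real (Suc n) \<le> 1 / real (Suc N)" using n by (simp add: field_simps)
      then show ?thesis using N by linarith
    qed
    have 2: "1 / (real (Suc n) * real (Suc m)) \<le> 1 / real (Suc n)"
      by (intro divide_left_mono) auto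
    have "norm (xpt (Suc n) (Suc m)) \<le> norm (1 / real (Suc n)) + norm (1 / (real (Suc n) * real (Suc m)))"
      unfolding xpt_def by (rule norm_Pair_le)
    also have "\<dots> < e" using 1 2 by simp
    finally have "xpt (Suc n) (Suc m) \<in> ball (0, 0) e"
      by (simp add: dist_norm flip: zero_prod_def)
    then show ?thesis using e(2) B by auto
  qed
  then show ?thesis by blast
qed

text \<open>The preimage of \<open>B\<close> under the quotient map contains
  \<open>(Suc p, 0)\<close>, hence an interval of the corresponding copy of \<open>S0\<close>. Its
  length, and so \<open>R\<close>, depends on \<open>p\<close>.\<close>

lemma ypt_tendsto:
  assumes "openin Vtop B" "y0 \<in> B"
  shows "\<exists>R. \<forall>r\<ge>R. ypt (Suc p) (Suc r) \<in> B"
proof -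
  have "openin NS0top {x \<in> posnat \<times> S0. Vq x \<in> B}" using assms(1) openin_Vtop by blast
  moreover have "(Suc p, 0) \<in> {x \<in> posnat \<times> S0. Vq x \<in> B}"
    using assms(2) by (simp add: S0_def Vq_def y0_def)
  ultimately obtain C D where CD: "openin (subtopology euclidean S0) D" "Suc p \<in> C" "0 \<in> D"
     "C \<times> D \<subseteq> {x \<in> posnat \<times> S0. Vq x \<in> B}"
    unfolding NS0top_def openin_prod_topology_alt by meson
  obtain E where E: "open E" "D = E \<inter> S0" using CD(1) unfolding openin_subtopology by auto
  obtain e where e: "e > 0" "ball 0 e \<subseteq> E" using E CD(3) by (metis Int_iff open_contains_ball)
  obtain N where N: "1 / real (Suc N) < e" using e(1) nat_approx_posE by metis
  have "ypt (Suc p) (Suc r) \<in> B" if "r \<ge> N" for r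
  proof -
    have "1 / real (Suc r) \<le> 1 / real (Suc N)" using that by (simp add: field_simps)
    then have "1 / real (Suc r) < e" using N by linarith
    then have "1 / real (Suc r) \<in> ball 0 e" by simp
    then have "(Suc p, 1 / real (Suc r)) \<in> C \<times> D" using e(2) E CD(2) S0_inverse_Suc[of r] by blast
    then show ?thesis using CD(4) unfolding ypt_def by blast
  qed
  then show ?thesis by blast
qed

lemma openin_Wtop_rectangle:
  assumes "openin Wtop U" "(x, y) \<in> U" "(x, y) \<in> Wset p"
  obtains A B where "openin Ktop A" "openin Vtop B" "x \<in> A" "y \<in> B" "(A \<times> B) \<inter> Wset p \<subseteq> U"
proof -
  have "openin (subtopology (prod_topology Ktop Vtop) (Wset p)) (U \<inter> Wset p)"
    using assms(1) openin_Wtop by blast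
  then obtain P where P: "openin (prod_topology Ktop Vtop) P" "U \<inter> Wset p = P \<inter> Wset p"
    unfolding openin_subtopology by auto
  have "(x, y) \<in> P" using P assms by auto
  then obtain A B where "openin Ktop A" "openin Vtop B" "x \<in> A" "y \<in> B" "A \<times> B \<subseteq> P"
    using P(1) unfolding openin_prod_topology_alt by meson
  then show ?thesis using P(2) by (intro that[of A B]) auto
qed

lemma z2_tendsto_z0:
  assumes "openin Wtop U" "z0 \<in> U"
  shows "\<exists>N. \<forall>n\<ge>N. \<forall>m. z2 (Suc n) (Suc m) \<in> U"
proof -
  obtain A B where AB: "openin Ktop A" "(0, 0) \<in> A" "y0 \<in> B" "(A \<times> B) \<inter> Wset 0 \<subseteq> U"
    using openin_Wtop_rectangle assms z0_in_Wset unfolding z0_def by metis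
  obtain N where "\<forall>n\<ge>N. \<forall>m. xpt (Suc n) (Suc m) \<in> A" using xpt_tendsto AB by blast
  then have "\<forall>n\<ge>N. \<forall>m. z2 (Suc n) (Suc m) \<in> (A \<times> B) \<inter> Wset 0"
    using AB(3) z2_in_Wset unfolding z2_def by blast
  then show ?thesis using AB(4) by blast
qed

text \<open>Uniformity in \<open>q\<close> comes from the index \<open>n + q\<close> in the second
  coordinate: it is large as soon as \<open>n\<close> is.\<close>

lemma z4_tendsto_z0:
  assumes "openin Wtop U" "z0 \<in> U"
  shows "\<exists>N. \<forall>n\<ge>N. \<forall>m q. z4 (Suc n) (Suc m) (Suc p) (Suc q) \<in> U"
proof -
  obtain A B where AB: "openin Ktop A" "openin Vtop B" "(0, 0) \<in> A" "y0 \<in> B"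
    "(A \<times> B) \<inter> Wset (Suc p) \<subseteq> U"
    using openin_Wtop_rectangle assms z0_in_Wset unfolding z0_def by metis
  obtain N where N: "\<forall>n\<ge>N. \<forall>m. xpt (Suc n) (Suc m) \<in> A" using xpt_tendsto AB by blast
  obtain R where R: "\<forall>r\<ge>R. ypt (Suc p) (Suc r) \<in> B" using ypt_tendsto AB by blast
  have "z4 (Suc n) (Suc m) (Suc p) (Suc q) \<in> (A \<times> B) \<inter> Wset (Suc p)" if "n \<ge> max N R" for n m q
    using N R that z4_in_Wset[of n m p q] unfolding z4_def by simp
  then show ?thesis using AB(5) by blast
qed

lemma z4_tendsto_z2:
  assumes "openin Wtop U" "z2 (Suc n) (Suc m) \<in> U"
  shows "\<exists>R. \<forall>q\<ge>R. z4 (Suc n) (Suc m) (Suc p) (Suc q) \<in> U"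
proof -
  obtain A B where AB: "openin Vtop B" "xpt (Suc n) (Suc m) \<in> A" "y0 \<in> B"
    "(A \<times> B) \<inter> Wset (Suc p) \<subseteq> U"
    using openin_Wtop_rectangle assms z2_in_Wset unfolding z2_def by metis
  obtain R where R: "\<forall>r\<ge>R. ypt (Suc p) (Suc r) \<in> B" using ypt_tendsto AB by blast
  have "z4 (Suc n) (Suc m) (Suc p) (Suc q) \<in> (A \<times> B) \<inter> Wset (Suc p)" if "q \<ge> R" for q
    using R that AB(2) z4_in_Wset[of n m p q] unfolding z4_def by simp
  then show ?thesis using AB(4) by blast
qed

section \<open>Removing points from the test space\<close>

lemma xpt_eq_iff: "xpt (Suc n) (Suc m) = xpt (Suc n') (Suc m') \<longleftrightarrow> n = n' \<and> m = m'"
  by (auto simp: xpt_def)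

lemma Kset_cases:
  assumes "x \<in> Kset"
  obtains "x = (0, 0)" | n m where "x = xpt (Suc n) (Suc m)"
proof -
  consider "x = (0, 0)" | n m where "n \<in> posnat" "m \<in> posnat" "x = xpt n m"
    using assms unfolding Kset_def by blast
  then show thesis
  proof cases
    case (2 n m)
    then show thesis using that(2)[of "n - 1" "m - 1"] by (simp add: posnat_def)
  qed (rule that(1))
qed

text \<open>A point \<open>(x, y)\<close> of \<open>Kset\<close> other than the origin has indices
  \<open>1 / x\<close> and \<open>x / y\<close>, and integers less than 1 apart coincide. Clearing
  denominators gives inequalities between continuous functions on the whole plane, which fail at the
  origin.\<close>

lemma openin_Ktop_xpt: "openin Ktop {xpt (Suc n) (Suc m)}"
proof -
  \<comment> \<open>On points with positive coordinates, \<open>?O\<close> says \<open>\<bar>1 / x - Suc n\<bar> < 1\<close> and \<open>\<bar>x / y - Suc m\<bar> < 1\<close>.\<close>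
  let ?O = "{z :: real \<times> real. \<bar>1 - real (Suc n) * fst z\<bar> < fst z} \<inter>
    {z. \<bar>fst z - real (Suc m) * snd z\<bar> < snd z}"
  have "open ?O" by (intro open_Int open_Collect_less continuous_intros)
  moreover have "{xpt (Suc n) (Suc m)} = ?O \<inter> Kset"
  proof (intro equalityI subsetI)
    fix z assume "z \<in> {xpt (Suc n) (Suc m)}"
    then have z: "z = xpt (Suc n) (Suc m)" by simp
    have "real (Suc m) * (1 / (real (Suc n) * real (Suc m))) = 1 / real (Suc n)"
      "real (Suc n) * (1 / real (Suc n)) = 1" by simp_all
    then have "z \<in> ?O" unfolding z xpt_def by (simp del: of_nat_Suc)
    then show "z \<in> ?O \<inter> Kset" using z by simp
  next
    fix z assume z: "z \<in> ?O \<inter> Kset"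
    then have "z \<in> Kset" by simp
    then show "z \<in> {xpt (Suc n) (Suc m)}"
    proof (cases rule: Kset_cases)
      case 1
      then show ?thesis using z by simp
    next
      case (2 n' m')
      define N M where "N = real (Suc n')" and "M = real (Suc m')"
      have pos: "N > 0" "M > 0" by (auto simp: N_def M_def)
      have z1: "\<bar>1 - real (Suc n) * (1 / N)\<bar> < 1 / N"
        and z2: "\<bar>1 / N - real (Suc m) * (1 / (N * M))\<bar> < 1 / (N * M)"
        using z unfolding 2 xpt_def N_def M_def by auto
      have "\<bar>N - real (Suc n)\<bar> = N * \<bar>1 - real (Suc n) * (1 / N)\<bar>"
        using pos by (simp add: abs_mult_pos' field_simps flip: abs_mult)
      also have "\<dots> < N * (1 / N)" using z1 pos by (intro mult_strict_left_mono) auto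
      finally have "\<bar>N - real (Suc n)\<bar> < 1" using pos by simp
      then have n: "n' = n" unfolding N_def by linarith
      have "\<bar>M - real (Suc m)\<bar> = (N * M) * \<bar>1 / N - real (Suc m) * (1 / (N * M))\<bar>"
        using pos by (simp add: abs_mult_pos' field_simps flip: abs_mult)
      also have "\<dots> < (N * M) * (1 / (N * M))" using z2 pos by (intro mult_strict_left_mono) auto
      finally have "\<bar>M - real (Suc m)\<bar> < 1" using pos by simp
      then have "m' = m" unfolding M_def by linarith
      then show ?thesis using 2 n by simp
    qed
  qed
  ultimately show ?thesis unfolding Ktop_def openin_subtopology by auto
qed

text \<open>A column is the part of \<open>Kset\<close> on a vertical line, which is closed and
  misses the origin.\<close>

lemma openin_Ktop_column_compl: "openin Ktop (Kset - range (\<lambda>m. xpt (Suc n) (Suc m)))"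
proof -
  let ?O = "- {z :: real \<times> real. fst z = 1 / real (Suc n)}"
  have "open ?O" by (intro open_Compl closed_Collect_eq continuous_intros)
  moreover have "Kset - range (\<lambda>m. xpt (Suc n) (Suc m)) = ?O \<inter> Kset"
  proof (intro equalityI subsetI)
    fix z assume z: "z \<in> Kset - range (\<lambda>m. xpt (Suc n) (Suc m))"
    then have "z \<in> Kset" by simp
    then show "z \<in> ?O \<inter> Kset"
      using z by (cases rule: Kset_cases) (auto simp: xpt_def)
  qed (auto simp: xpt_def)
  ultimately show ?thesis unfolding Ktop_def openin_subtopology by auto
qed

text \<open>Away from the collapsed fibre \<open>Vq\<close> is the identity, so the preimage of
  \<open>F\<close> is finite and therefore closed in a Hausdorff space.\<close>

lemma openin_Vtop_finite_compl:
  assumes "finite F" "F \<subseteq> topspace Vtop" "y0 \<notin> F"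
  shows "openin Vtop (topspace Vtop - F)"
  unfolding openin_Vtop
proof
  have eq: "{x \<in> posnat \<times> S0. Vq x \<in> topspace Vtop - F} = topspace NS0top - (F \<inter> topspace NS0top)"
    using assms(2,3) by (auto simp: topspace_Vtop topspace_NS0top Vq_def y0_def split: if_splits)
  have "Hausdorff_space NS0top"
    unfolding NS0top_def by (simp add: Hausdorff_space_prod_topology Hausdorff_space_subtopology)
  then have "closedin NS0top (F \<inter> topspace NS0top)"
    using assms(1) by (intro closedin_Hausdorff_finite) auto
  then show "openin NS0top {x \<in> posnat \<times> S0. Vq x \<in> topspace Vtop - F}"
    unfolding eq by (intro openin_diff) auto
qed auto

text \<open>Off the column nothing is removed. On it each first coordinate is isolated in
  \<open>Ktop\<close>, and only finitely many second coordinates, all different from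
  \<open>y0\<close>, are removed there. The complement is thus a union of open rectangles.\<close>

lemma openin_z4_column_compl:
  "openin (prod_topology Ktop Vtop) (topspace (prod_topology Ktop Vtop) -
    {z4 (Suc n) (Suc m) (Suc p) (Suc q) |m q. q < Q m})"
proof -
  define F where "F m = (\<lambda>q. ypt (Suc p) (Suc n + Suc q)) ` {..<Q m}" for m
  have "topspace (prod_topology Ktop Vtop) - {z4 (Suc n) (Suc m) (Suc p) (Suc q) |m q. q < Q m} =
    (Kset - range (\<lambda>m. xpt (Suc n) (Suc m))) \<times> topspace Vtop \<union>
    (\<Union>m. {xpt (Suc n) (Suc m)} \<times> (topspace Vtop - F m))" (is "?L = ?R")
  proof (intro equalityI subsetI)
    fix z assume z: "z \<in> ?L"
    obtain x y where xy: "z = (x, y)" by (cases z)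
    show "z \<in> ?R"
    proof (cases "x \<in> range (\<lambda>m. xpt (Suc n) (Suc m))")
      case True
      then obtain m where m: "x = xpt (Suc n) (Suc m)" by auto
      have "y \<notin> F m" using z unfolding xy m F_def z4_def by blast
      then show ?thesis using z unfolding xy m by auto
    qed (use z xy in \<open>auto simp: topspace_Ktop\<close>)
  next
    fix z assume "z \<in> ?R"
    then show "z \<in> ?L"
      by (auto simp: topspace_Ktop z4_def F_def xpt_eq_iff)
  qed
  moreover have "openin Vtop (topspace Vtop - F m)" for m
  proof (rule openin_Vtop_finite_compl)
    show "F m \<subseteq> topspace Vtop" unfolding F_def using ypt_in_Vtop[of p] by auto
  qed (auto simp: F_def ypt_eq y0_def)
  then have "openin (prod_topology Ktop Vtop) ?R"
    by (intro openin_Un openin_Union ballI)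
      (auto simp: openin_prod_Times_iff openin_Ktop_xpt openin_Ktop_column_compl)
  ultimately show ?thesis by simp
qed

text \<open>The first component of the second factor records the stage at which a point is added.
  This shows that points removed at later stages do not affect \<open>Wset p\<close>.\<close>

lemma fst_snd_Wset_le: "w \<in> Wset p \<Longrightarrow> fst (snd w) \<le> p"
proof (induction p)
  case (Suc p)
  have "fst (snd (z4 n m (Suc p) q)) \<le> Suc p" for n m q
    by (simp add: z4_def ypt_def Vq_def)
  then show ?case using Suc by fastforce
qed (auto simp: z0_def z2_def y0_def)

text \<open>Infinitely many sets are removed, but each stage meets only finitely many of them, and
  openness in the direct limit is tested stage by stage.\<close>

lemma Wtop_separating_nbhd:
  "\<exists>U. openin Wtop U \<and> z0 \<in> U \<and>
    (\<forall>p m q. z4 (Suc (\<nu> p)) (Suc m) (Suc p) (Suc q) \<in> U \<longrightarrow> Q m p \<le> q)"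
proof -
  define D where "D p = {z4 (Suc (\<nu> p)) (Suc m) (Suc p) (Suc q) |m q. q < Q m p}" for p
  let ?P = "prod_topology Ktop Vtop"
  let ?U = "topspace Wtop - (\<Union>p. D p)"
  have D_snd: "fst (snd w) = Suc p" if "w \<in> D p" for w p
    using that by (auto simp: D_def z4_def ypt_eq)
  have "openin Wtop ?U"
    unfolding openin_Wtop
  proof (intro conjI allI)
    fix p
    \<comment> \<open>The set \<open>D p'\<close> belongs to branch \<open>Suc p'\<close>, so
      already \<open>p' = p\<close> is disjoint from \<open>Wset p\<close>.\<close>
    have DW: "w \<notin> D p'" if "w \<in> Wset p" "p' \<ge> p" for w p'
      using fst_snd_Wset_le[OF that(1)] D_snd[of w p'] that(2) by force
    \<comment> \<open>The factor \<open>topspace ?P\<close> covers \<open>p = 0\<close>, where the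
      intersection is over an empty family.\<close>
    have "?U \<inter> Wset p = ((\<Inter>p'\<in>{..<p}. topspace ?P - D p') \<inter> topspace ?P) \<inter> Wset p"
    proof (intro equalityI subsetI)
      fix w assume "w \<in> ?U \<inter> Wset p"
      then show "w \<in> ((\<Inter>p'\<in>{..<p}. topspace ?P - D p') \<inter> topspace ?P) \<inter> Wset p"
        using Wset_subset[of p] by blast
    next
      fix w assume w: "w \<in> ((\<Inter>p'\<in>{..<p}. topspace ?P - D p') \<inter> topspace ?P) \<inter> Wset p"
      have "w \<notin> D p'" for p'
      proof (cases "p' < p")
        case True
        then show ?thesis using w by blast
      qed (use w DW[of w p'] in auto)
      then show "w \<in> ?U \<inter> Wset p" using w topspace_Wtop by auto
    qed
    moreover have "openin ?P ((\<Inter>p'\<in>{..<p}. topspace ?P - D p') \<inter> topspace ?P)"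
      unfolding D_def by (intro openin_INT openin_z4_column_compl) auto
    ultimately show "openin (subtopology ?P (Wset p)) (?U \<inter> Wset p)"
      unfolding openin_subtopology by metis
  qed auto
  moreover have "z0 \<in> ?U"
  proof -
    have "z0 \<notin> D p" for p using D_snd[of z0 p] by (auto simp: z0_def y0_def)
    then show ?thesis by simp
  qed
  moreover have "Q m p \<le> q" if "z4 (Suc (\<nu> p)) (Suc m) (Suc p) (Suc q) \<in> ?U" for p m q
  proof (rule ccontr)
    assume "\<not> Q m p \<le> q"
    then have "z4 (Suc (\<nu> p)) (Suc m) (Suc p) (Suc q) \<in> D p"
      unfolding D_def using not_le by blast
    then show False using that by blast
  qed
  ultimately show ?thesis by blast
qed

section \<open>Transfer from the test space to the group\<close>

theorem theorem3:
  fixes G :: "('a, 'm) monoid_scheme" and T :: "'a topology"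
    and X :: "nat \<Rightarrow> 'b topology"
  assumes "topological_group G T"
    and "\<exists>S. S \<subseteq> topspace T \<and> (subtopology T S) homeomorphic_space Wtop"
    and "\<forall>n. property_M TYPE(nat \<Rightarrow> real) (X n)"
  shows "\<not> (\<exists>S. T homeomorphic_space (subtopology (product_topology X UNIV) S))"
proof
  assume "\<exists>S. T homeomorphic_space (subtopology (product_topology X UNIV) S)"
  then obtain S \<phi> where \<phi>: "homeomorphic_map T (subtopology (product_topology X UNIV) S) \<phi>"
    unfolding homeomorphic_space by blast
  obtain R \<psi> where \<psi>: "homeomorphic_map Wtop (subtopology T R) \<psi>"
    using assms(2) homeomorphic_space homeomorphic_space_sym by metis
  have ts: "topspace T = carrier G" using assms(1) by (simp add: topological_group_def)
  have cont: "continuous_map Wtop (subtopology T R) \<psi>" and inj: "inj_on \<psi> (topspace Wtop)"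
    using \<psi> by (simp_all only: homeomorphic_eq_everything_map)
  have \<psi>T: "\<psi> w \<in> carrier G \<inter> R" if "w \<in> topspace Wtop" for w
    using continuous_map_image_subset_topspace[OF cont] that ts by auto
  have "continuous_map Wtop T \<psi>" using cont by (simp add: continuous_map_in_subtopology)
  note pre = openin_continuous_map_preimage[OF this]
  show False
  proof (rule topological_group_not_in_product[where ?a0.0 = "\<psi> z0"
        and a = "\<lambda>n m. \<psi> (z2 (Suc n) (Suc m))"
        and b = "\<lambda>n m p q. \<psi> (z4 (Suc n) (Suc m) (Suc p) (Suc q))",
        OF assms(1) _ _ _ _ _ _ _ _ \<phi>])
    show "property_M TYPE(nat \<Rightarrow> real) (X k)" for k using assms(3) by blast
    show "\<psi> z0 \<in> carrier G" "\<psi> (z2 (Suc n) (Suc m)) \<in> carrier G"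
      "\<psi> (z4 (Suc n) (Suc m) (Suc p) (Suc q)) \<in> carrier G" for n m p q
      using \<psi>T by auto
  next
    fix U assume "openin T U" "\<psi> z0 \<in> U"
    then show "\<exists>N. \<forall>n\<ge>N. \<forall>m. \<psi> (z2 (Suc n) (Suc m)) \<in> U"
      using z2_tendsto_z0[OF pre[of U]] by simp
  next
    fix U p assume "openin T U" "\<psi> z0 \<in> U"
    then show "\<exists>N. \<forall>n\<ge>N. \<forall>m q. \<psi> (z4 (Suc n) (Suc m) (Suc p) (Suc q)) \<in> U"
      using z4_tendsto_z0[OF pre[of U], of p] by simp
  next
    fix U n m p assume "openin T U" "\<psi> (z2 (Suc n) (Suc m)) \<in> U"
    then show "\<exists>L. \<forall>q\<ge>L. \<psi> (z4 (Suc n) (Suc m) (Suc p) (Suc q)) \<in> U"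
      using z4_tendsto_z2[OF pre[of U], of n m p] by simp
  next
    fix \<nu> :: "nat \<Rightarrow> nat" and Q :: "nat \<Rightarrow> nat \<Rightarrow> nat"
    obtain O' where O': "openin Wtop O'" "z0 \<in> O'"
      "\<And>p m q. z4 (Suc (\<nu> p)) (Suc m) (Suc p) (Suc q) \<in> O' \<Longrightarrow> Q m p \<le> q"
      using Wtop_separating_nbhd[of \<nu> Q] by blast
    have sub: "O' \<subseteq> topspace Wtop" using O'(1) openin_subset by blast
    have "openin (subtopology T R) (\<psi> ` O')"
      using homeomorphic_map_openness[OF \<psi> sub] O'(1) by simp
    then obtain U where U: "openin T U" "\<psi> ` O' = U \<inter> R" unfolding openin_subtopology by auto
    \<comment> \<open>\<open>U\<close> may contain group elements outside the copy of the test
      space, but on that copy its trace is the image of \<open>O'\<close>, and \<open>\<psi>\<close>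
      is injective.\<close>
    have "w \<in> O'" if "w \<in> topspace Wtop" "\<psi> w \<in> U" for w
    proof -
      have "\<psi> w \<in> \<psi> ` O'" using U(2) \<psi>T that by auto
      then show ?thesis using inj sub that(1) by (meson inj_on_image_mem_iff)
    qed
    then show "\<exists>U. openin T U \<and> \<psi> z0 \<in> U \<and>
        (\<forall>m p q. \<psi> (z4 (Suc (\<nu> p)) (Suc m) (Suc p) (Suc q)) \<in> U \<longrightarrow> Q m p \<le> q)"
      using U O' by (intro exI[of _ U]) auto
  qed
qed

end
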